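(* $t(K(8,3)) =\frac{5}{3}$. Moreover, if $S$ is a vertex cut of $K(8,3)$ such that $\frac{|S|}{c(K(8,3)\setminus S)} = \frac{5}{3}$, then $S$ is the complement of a maximum independent set of $K(8,3)$.
   Context: The Kneser graph $K(n,k)$ has as vertices the $k$-element subsets of $[n]=\{1,\dots,n\}$, two vertices being adjacent iff they are disjoint. A vertex cut is a set $S$ of vertices whose removal disconnects the graph; $c(G\setminus S)$ is the number of connected components after deleting $S$; the toughness is $t(G)=\min_S |S|/c(G\setminus S)$ over vertex cuts $S$. *)

theory Defs
  imports Complex_Main
begin

(* A simple graph is given by a vertex set V and a symmetric adjacency relation E. *)

definition kneser_vertices :: "nat \<Rightarrow> nat \<Rightarrow> nat set set" where
  "kneser_vertices n k = {A. A \<subseteq> {1..n} \<and> card A = k}"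

definition kneser_adj :: "nat set \<Rightarrow> nat set \<Rightarrow> bool" where
  "kneser_adj A B \<longleftrightarrow> A \<inter> B = {}"

definition conn_rel :: "'a set \<Rightarrow> ('a \<Rightarrow> 'a \<Rightarrow> bool) \<Rightarrow> 'a set \<Rightarrow> ('a \<times> 'a) set" where
  "conn_rel V E S = ({(x,y). x \<in> V - S \<and> y \<in> V - S \<and> E x y})\<^sup>* \<inter> ((V - S) \<times> (V - S))"

definition num_components :: "'a set \<Rightarrow> ('a \<Rightarrow> 'a \<Rightarrow> bool) \<Rightarrow> 'a set \<Rightarrow> nat" where
  "num_components V E S = card ((V - S) // conn_rel V E S)"

definition vertex_cut :: "'a set \<Rightarrow> ('a \<Rightarrow> 'a \<Rightarrow> bool) \<Rightarrow> 'a set \<Rightarrow> bool" where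
  "vertex_cut V E S \<longleftrightarrow> S \<subseteq> V \<and> num_components V E S \<ge> 2"

definition toughness :: "'a set \<Rightarrow> ('a \<Rightarrow> 'a \<Rightarrow> bool) \<Rightarrow> real" where
  "toughness V E = Inf {real (card S) / real (num_components V E S) | S. vertex_cut V E S}"

definition independent_set :: "'a set \<Rightarrow> ('a \<Rightarrow> 'a \<Rightarrow> bool) \<Rightarrow> 'a set \<Rightarrow> bool" where
  "independent_set V E I \<longleftrightarrow> I \<subseteq> V \<and> (\<forall>x\<in>I. \<forall>y\<in>I. \<not> E x y)"

definition maximum_independent_set :: "'a set \<Rightarrow> ('a \<Rightarrow> 'a \<Rightarrow> bool) \<Rightarrow> 'a set \<Rightarrow> bool" where
  "maximum_independent_set V E I \<longleftrightarrow> independent_set V E I \<and>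
     (\<forall>J. independent_set V E J \<longrightarrow> card J \<le> card I)"

end

theory Submission
  imports Defs
begin

text \<open>The adjacency matrix M of K(8,3) satisfies \<open>M + 6 I - 2/7 J \<ge> 0\<close>.  Let the components of
  the graph minus S have m vertices and D ordered adjacent pairs each.  Evaluating the form at the
  vector that is \<open>m/(6m+D)\<close> on each component gives \<open>\<Sum> m\<^sup>2/(6m+D) \<le> 7/2\<close>, because there are no
  edges between components.  Each summand is at least \<open>(3m+5)/48\<close>, with equality only for
  \<open>m = 1\<close>; summing up yields \<open>3 (56 - |S|) + 5 c \<le> 168\<close>, that is \<open>5 c \<le> 3 |S|\<close>.  In the case of
  equality all components are singletons, so the complement of S is independent of size 21.\<close>

section \<open>Sums of squares as quadratic forms, and counts of supersets\<close>

lemma sum_sum_products: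
  fixes \<phi> \<psi> :: "'z \<Rightarrow> 'a \<Rightarrow> 'r::comm_semiring_0"
  shows "(\<Sum>z\<in>Z. (\<Sum>a\<in>X. \<phi> z a) * (\<Sum>b\<in>Y. \<psi> z b)) = (\<Sum>a\<in>X. \<Sum>b\<in>Y. \<Sum>z\<in>Z. \<phi> z a * \<psi> z b)"
proof -
  have "(\<Sum>z\<in>Z. (\<Sum>a\<in>X. \<phi> z a) * (\<Sum>b\<in>Y. \<psi> z b)) = (\<Sum>z\<in>Z. \<Sum>a\<in>X. \<Sum>b\<in>Y. \<phi> z a * \<psi> z b)"
    by (simp add: sum_product)
  also have "\<dots> = (\<Sum>a\<in>X. \<Sum>z\<in>Z. \<Sum>b\<in>Y. \<phi> z a * \<psi> z b)"
    by (rule sum.swap)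
  also have "\<dots> = (\<Sum>a\<in>X. \<Sum>b\<in>Y. \<Sum>z\<in>Z. \<phi> z a * \<psi> z b)"
    by (rule sum.cong[OF refl], rule sum.swap)
  finally show ?thesis .
qed

text \<open>Serves to compute squared norms of images under incidence maps, where the Gram entries
  are intersection sizes, their squares, or numbers of triples through two points.\<close>

lemma sum_squares_gram:
  fixes \<phi> :: "'z \<Rightarrow> 'a \<Rightarrow> real"
  shows "(\<Sum>z\<in>Z. (\<Sum>a\<in>X. \<phi> z a * f a)\<^sup>2) = (\<Sum>a\<in>X. \<Sum>b\<in>X. (\<Sum>z\<in>Z. \<phi> z a * \<phi> z b) * (f a * f b))"
  unfolding power2_eq_square sum_sum_products
  by (intro sum.cong refl) (simp add: sum_distrib_left sum_distrib_right mult_ac)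

lemma card_supersets_of_card:
  assumes "finite P" "X \<subseteq> P"
  shows "card {A. A \<subseteq> P \<and> card A = card X + j \<and> X \<subseteq> A} = (card P - card X) choose j"
proof -
  have fX: "finite X" using assms finite_subset by blast
  have "bij_betw (\<lambda>B. B \<union> X) {B. B \<subseteq> P - X \<and> card B = j} {A. A \<subseteq> P \<and> card A = card X + j \<and> X \<subseteq> A}"
  proof (rule bij_betw_byWitness[where f' = "\<lambda>A. A - X"])
    show "(\<lambda>B. B \<union> X) ` {B. B \<subseteq> P - X \<and> card B = j} \<subseteq> {A. A \<subseteq> P \<and> card A = card X + j \<and> X \<subseteq> A}"
    proof clarify
      fix B assume B: "B \<subseteq> P - X" "j = card B"
      have "finite B" using B assms(1) finite_subset by blast
      then have "card (B \<union> X) = card B + card X" using B fX by (intro card_Un_disjoint) auto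
      then show "B \<union> X \<subseteq> P \<and> card (B \<union> X) = card X + card B \<and> X \<subseteq> B \<union> X" using B assms by auto
    qed
    show "(\<lambda>A. A - X) ` {A. A \<subseteq> P \<and> card A = card X + j \<and> X \<subseteq> A} \<subseteq> {B. B \<subseteq> P - X \<and> card B = j}"
      using fX by (auto simp: card_Diff_subset)
  qed auto
  then have "card {A. A \<subseteq> P \<and> card A = card X + j \<and> X \<subseteq> A} = card {B. B \<subseteq> P - X \<and> card B = j}"
    by (simp add: bij_betw_same_card)
  also have "\<dots> = (card P - card X) choose j"
    using assms fX by (simp add: n_subsets card_Diff_subset)
  finally show ?thesis .
qed

section \<open>The graph K(8,3): degree and incidence counts\<close>

abbreviation K83 :: "nat set set" where "K83 \<equiv> kneser_vertices 8 3"

abbreviation adj :: "nat set \<Rightarrow> nat set \<Rightarrow> 'r::zero_neq_one" where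
  "adj A B \<equiv> of_bool (kneser_adj A B)"

lemma K83_iff: "A \<in> K83 \<longleftrightarrow> A \<subseteq> {1..8} \<and> card A = 3"
  by (simp add: kneser_vertices_def)

lemma K83_finite [simp]: "finite K83"
  by (rule finite_subset[of _ "Pow {1..8}"]) (blast dest: K83_iff[THEN iffD1], simp)

lemma card_K83: "card K83 = 56"
  by (simp add: kneser_vertices_def n_subsets) (simp add: eval_nat_numeral)

lemma K83_degree:
  assumes "A \<in> K83" shows "(\<Sum>B\<in>K83. adj A B) = (10::nat)"
proof -
  have fA: "finite A" using assms finite_subset by (auto simp: K83_iff)
  have "(\<Sum>B\<in>K83. adj A B) = card {B \<in> K83. kneser_adj A B}"
    by (simp add: sum_of_bool_eq Collect_conj_eq)
  also have "{B \<in> K83. kneser_adj A B} = {B. B \<subseteq> {1..8} - A \<and> card B = 3}"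
    by (auto simp: K83_iff kneser_adj_def)
  also have "card \<dots> = 10"
    using assms fA by (simp add: K83_iff n_subsets card_Diff_subset) (simp add: eval_nat_numeral)
  finally show ?thesis .
qed

lemma K83_incidence:
  assumes "x \<in> {1..8}"
  shows "(\<Sum>A\<in>K83. of_bool (x \<in> A)) = (21::real)"
proof -
  have "{A \<in> K83. x \<in> A} = {A. A \<subseteq> {1..8} \<and> card A = card {x} + 2 \<and> {x} \<subseteq> A}"
    by (auto simp: K83_iff)
  also have "card \<dots> = 21"
    using assms by (subst card_supersets_of_card) (auto simp: eval_nat_numeral)
  finally show ?thesis by (simp add: sum_of_bool_eq Collect_conj_eq)
qed

lemma K83_pair_incidence:
  assumes "x \<in> {1..8}" "y \<in> {1..8}"
  shows "(\<Sum>A\<in>K83. of_bool (x \<in> A) * of_bool (y \<in> A)) = (15 * of_bool (x = y) + 6 :: real)"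
proof (cases "x = y")
  case True
  then show ?thesis using K83_incidence[OF assms(1)] by (simp flip: of_bool_conj)
next
  case False
  have "{A \<in> K83. x \<in> A \<and> y \<in> A} = {A. A \<subseteq> {1..8} \<and> card A = card {x,y} + 1 \<and> {x,y} \<subseteq> A}"
    using False by (auto simp: K83_iff)
  also have "card \<dots> = 6"
    using assms False by (subst card_supersets_of_card) auto
  finally show ?thesis using False by (simp add: sum_of_bool_eq Collect_conj_eq flip: of_bool_conj)
qed

section \<open>The quadratic form of the adjacency matrix\<close>

text \<open>The least eigenvalue of the adjacency matrix is -6.  The two squares are supported on the
  orthogonal complement of the functions of the form \<open>A \<mapsto> (\<Sum>x\<in>A. a x)\<close>.\<close>

lemma K83_quadratic_form_lower_bound:
  fixes f :: "nat set \<Rightarrow> real"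
  shows "2/7 * (\<Sum>A\<in>K83. f A)\<^sup>2 \<le> (\<Sum>A\<in>K83. \<Sum>B\<in>K83. adj A B * (f A * f B)) + 6 * (\<Sum>A\<in>K83. (f A)\<^sup>2)"
proof -
  define P where "P = {1..8::nat}"
  define \<chi> where "\<chi> x A = (of_bool (x \<in> A) :: real)" for x :: nat and A
  define F where "F = (\<Sum>A\<in>K83. f A)"
  define q where "q = (\<Sum>A\<in>K83. (f A)\<^sup>2)"
  \<comment> \<open>\<open>g\<close> and \<open>h\<close> collect the weight of \<open>f\<close> on
    the triples through one and two points, and \<open>u\<close> carries \<open>g\<close> back to
    triples. The squared norms \<open>G\<close> and \<open>K\<close> will be the quadratic forms
    with kernels \<open>card (A \<inter> B)\<close> and its square.\<close>
  define g where "g x = (\<Sum>A\<in>K83. \<chi> x A * f A)" for x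
  define h where "h x y = (\<Sum>A\<in>K83. \<chi> x A * \<chi> y A * f A)" for x y
  define u where "u A = (\<Sum>x\<in>P. \<chi> x A * g x)" for A
  define G where "G = (\<Sum>x\<in>P. (g x)\<^sup>2)"
  define K where "K = (\<Sum>x\<in>P. \<Sum>y\<in>P. (h x y)\<^sup>2)"
  have finP: "finite P" and cardP: "card P = 8" by (auto simp: P_def)
  have \<chi>card: "(\<Sum>x\<in>P. \<chi> x A) = 3" if "A \<in> K83" for A
  proof -
    have "P \<inter> A = A" using that by (auto simp: K83_iff P_def)
    then show ?thesis using that finP by (simp add: \<chi>_def sum_of_bool_eq K83_iff Int_def)
  qed
  have \<chi>int: "(\<Sum>x\<in>P. \<chi> x A * \<chi> x B) = card (A \<inter> B)" if "A \<in> K83" for A B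
  proof -
    have "{x \<in> P. x \<in> A \<and> x \<in> B} = A \<inter> B" using that by (auto simp: K83_iff P_def)
    then show ?thesis using finP by (simp add: \<chi>_def sum_of_bool_eq Collect_conj_eq flip: of_bool_conj)
  qed
  have G_eq: "G = (\<Sum>A\<in>K83. \<Sum>B\<in>K83. real (card (A \<inter> B)) * (f A * f B))"
    unfolding G_def g_def sum_squares_gram by (intro sum.cong refl) (simp add: \<chi>int)
  have "K = (\<Sum>(x,y)\<in>P\<times>P. (h x y)\<^sup>2)" by (simp add: K_def sum.cartesian_product)
  also have "\<dots> = (\<Sum>z\<in>P\<times>P. (\<Sum>A\<in>K83. (\<chi> (fst z) A * \<chi> (snd z) A) * f A)\<^sup>2)"
    by (simp add: h_def case_prod_unfold)
  also have "\<dots> = (\<Sum>A\<in>K83. \<Sum>B\<in>K83. (real (card (A \<inter> B)))\<^sup>2 * (f A * f B))"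
    unfolding sum_squares_gram
  proof (intro sum.cong refl)
    fix A B assume "A \<in> K83"
    have "(\<Sum>z\<in>P\<times>P. \<chi> (fst z) A * \<chi> (snd z) A * (\<chi> (fst z) B * \<chi> (snd z) B))
        = (\<Sum>x\<in>P. \<Sum>y\<in>P. (\<chi> x A * \<chi> x B) * (\<chi> y A * \<chi> y B))"
      by (simp add: sum.cartesian_product case_prod_unfold algebra_simps)
    also have "\<dots> = (real (card (A \<inter> B)))\<^sup>2"
      using \<open>A \<in> K83\<close> by (simp add: power2_eq_square \<chi>int flip: sum_product)
    finally show "(\<Sum>z\<in>P\<times>P. \<chi> (fst z) A * \<chi> (snd z) A * (\<chi> (fst z) B * \<chi> (snd z) B)) * (f A * f B)
       = (real (card (A \<inter> B)))\<^sup>2 * (f A * f B)" by simp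
  qed
  finally have K_eq: "K = (\<Sum>A\<in>K83. \<Sum>B\<in>K83. (real (card (A \<inter> B)))\<^sup>2 * (f A * f B))" .
  have F2_eq: "F\<^sup>2 = (\<Sum>A\<in>K83. \<Sum>B\<in>K83. f A * f B)"
    by (simp add: F_def power2_eq_square sum_product)
  have q_eq: "q = (\<Sum>A\<in>K83. \<Sum>B\<in>K83. of_bool (A = B) * (f A * f B))"
    by (simp add: q_def of_bool_def if_distrib[of "\<lambda>t. t * _"] power2_eq_square cong: if_cong)
  \<comment> \<open>For \<open>k = card (A \<inter> B)\<close> the polynomial
    \<open>(k - 1) * (k - 2) / 2\<close> takes the values 1, 0, 0, 1 at 0, 1, 2, 3; removing the
    diagonal leaves adjacency.\<close>
  have adj_eq: "adj A B = 1 - 3/2 * real (card (A \<inter> B)) + 1/2 * (real (card (A \<inter> B)))\<^sup>2 - of_bool (A = B)"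
    if "A \<in> K83" "B \<in> K83" for A B
  proof -
    have fin: "finite A" "finite B" "card A = 3" "card B = 3" using that finite_subset by (auto simp: K83_iff)
    have le: "card (A \<inter> B) \<le> 3" using fin by (metis card_mono inf_le1)
    have "card (A \<inter> B) = 3 \<longleftrightarrow> A = B"
      using fin by (metis card_subset_eq inf.idem inf_le1 inf_le2)
    moreover have "card (A \<inter> B) = 0 \<longleftrightarrow> kneser_adj A B" using fin by (simp add: kneser_adj_def)
    moreover have "card (A \<inter> B) \<in> {0,1,2,3}" using le by auto
    ultimately show ?thesis by (auto simp: power2_eq_square)
  qed
  have "(\<Sum>A\<in>K83. \<Sum>B\<in>K83. adj A B * (f A * f B))
     = (\<Sum>A\<in>K83. \<Sum>B\<in>K83. f A * f B - 3/2 * (real (card (A \<inter> B)) * (f A * f B))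
         + 1/2 * ((real (card (A \<inter> B)))\<^sup>2 * (f A * f B)) - of_bool (A = B) * (f A * f B))"
    by (intro sum.cong refl) (simp only: adj_eq, simp add: algebra_simps)
  also have "\<dots> = F\<^sup>2 - 3/2 * G + 1/2 * K - q"
    unfolding F2_eq G_eq K_eq q_eq by (simp add: sum.distrib sum_subtractf sum_distrib_left)
  finally have form: "(\<Sum>A\<in>K83. \<Sum>B\<in>K83. adj A B * (f A * f B)) = F\<^sup>2 - 3/2 * G + 1/2 * K - q" .

  have sum_g: "(\<Sum>x\<in>P. g x) = 3 * F"
    unfolding g_def by (subst sum.swap) (simp add: \<chi>card F_def sum_distrib_left flip: sum_distrib_right)
  have sum_h: "(\<Sum>y\<in>P. h x y) = 3 * g x" for x
  proof -
    have "(\<Sum>y\<in>P. h x y) = (\<Sum>A\<in>K83. (\<Sum>y\<in>P. \<chi> y A) * (\<chi> x A * f A))"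
      unfolding h_def by (subst sum.swap) (simp add: sum_distrib_right sum_distrib_left algebra_simps)
    then show ?thesis by (simp add: \<chi>card g_def sum_distrib_left)
  qed
  have h_sym: "h x y = h y x" for x y by (simp add: h_def algebra_simps)
  have h_diag: "h x x = g x" for x
    by (simp add: h_def g_def \<chi>_def flip: of_bool_conj)
  have sum_u: "(\<Sum>A\<in>K83. u A) = 63 * F"
  proof -
    have "(\<Sum>A\<in>K83. u A) = (\<Sum>x\<in>P. (\<Sum>A\<in>K83. \<chi> x A) * g x)"
      unfolding u_def by (subst sum.swap) (simp add: sum_distrib_right)
    also have "\<dots> = (\<Sum>x\<in>P. 21 * g x)"
      by (intro sum.cong refl) (simp only: \<chi>_def P_def K83_incidence)
    finally show ?thesis by (simp add: sum_g flip: sum_distrib_left)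
  qed
  have sum_fu: "(\<Sum>A\<in>K83. f A * u A) = G"
  proof -
    have "(\<Sum>A\<in>K83. f A * u A) = (\<Sum>x\<in>P. (\<Sum>A\<in>K83. \<chi> x A * f A) * g x)"
      unfolding u_def sum_distrib_left sum_distrib_right by (subst sum.swap) (simp add: mult_ac)
    then show ?thesis by (simp add: G_def power2_eq_square flip: g_def)
  qed
  have sum_u2: "(\<Sum>A\<in>K83. (u A)\<^sup>2) = 15 * G + 54 * F\<^sup>2"
  proof -
    have "(\<Sum>A\<in>K83. (u A)\<^sup>2) = (\<Sum>x\<in>P. \<Sum>y\<in>P. (15 * of_bool (x = y) + 6) * (g x * g y))"
      unfolding u_def sum_squares_gram
      by (intro sum.cong refl) (simp only: \<chi>_def P_def K83_pair_incidence)
    also have "\<dots> = (\<Sum>x\<in>P. 15 * (g x)\<^sup>2 + 6 * g x * (3 * F))"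
    proof (intro sum.cong refl)
      fix x assume "x \<in> P"
      have "(\<Sum>y\<in>P. (15 * of_bool (x = y) + 6) * (g x * g y))
          = (\<Sum>y\<in>P. (if x = y then 15 * (g x * g y) else 0) + 6 * g x * g y)"
        by (intro sum.cong refl) (simp add: algebra_simps)
      then show "(\<Sum>y\<in>P. (15 * of_bool (x = y) + 6) * (g x * g y)) = 15 * (g x)\<^sup>2 + 6 * g x * (3 * F)"
        using finP \<open>x \<in> P\<close> by (simp add: sum.distrib power2_eq_square sum_g flip: sum_distrib_left)
    qed
    also have "\<dots> = 15 * G + 18 * F * (\<Sum>x\<in>P. g x)"
      unfolding G_def sum.distrib sum_distrib_left by (simp add: mult_ac)
    finally show ?thesis by (simp add: sum_g power2_eq_square)
  qed

  \<comment> \<open>\<open>u A / 15 - 2/35 * F\<close> is the orthogonal projection of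
    \<open>f\<close> onto the span of the functions \<open>\<chi> x\<close>, whose Gram matrix
    \<open>15 I + 6 J\<close> has inverse \<open>(I - 2/21 J) / 15\<close>. The squared norm of the
    residual is computed here.\<close>
  have "0 \<le> (\<Sum>A\<in>K83. (f A - u A / 15 + 2/35 * F)\<^sup>2)" by (simp add: sum_nonneg)
  also have "\<dots> = (\<Sum>A\<in>K83. (f A)\<^sup>2 + 1/225 * (u A)\<^sup>2 + 4/1225 * F\<^sup>2
       - 2/15 * (f A * u A) + 4/35 * F * f A - 4/525 * F * u A)"
    by (intro sum.cong refl) (simp add: power2_eq_square field_simps)
  also have "\<dots> = q + 1/225 * (15 * G + 54 * F\<^sup>2) + 56 * (4/1225 * F\<^sup>2) - 2/15 * G
       + 4/35 * F * F - 4/525 * F * (63 * F)"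
    by (simp only: sum.distrib sum_subtractf flip: sum_distrib_left)
       (simp add: sum_u sum_u2 sum_fu card_K83 q_def F_def)
  also have "\<dots> = q - G / 15 + 2/35 * F\<^sup>2" by (simp add: power2_eq_square field_simps)
  finally have sq1: "0 \<le> q - G / 15 + 2/35 * F\<^sup>2" .

  \<comment> \<open>The corrections to \<open>h\<close> make the off-diagonal row sums of
    \<open>E\<close> vanish: \<open>2 * g x - (7 * g x + 3 * F - g x) / 3 + F = 0\<close>. The sum
    of squares over all pairs minus the diagonal ones is then the nonnegative quantity in
    \<open>sq2\<close>.\<close>
  define E where "E x y = h x y - (g x + g y) / 3 + F / 7" for x y
  have "(\<Sum>x\<in>P. (E x x)\<^sup>2) \<le> (\<Sum>x\<in>P. \<Sum>y\<in>P. (E x y)\<^sup>2)"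
    by (intro sum_mono member_le_sum) (auto simp: finP)
  moreover have "(\<Sum>x\<in>P. (E x x)\<^sup>2) = (\<Sum>x\<in>P. 1/9 * (g x)\<^sup>2 + 2/21 * F * g x + F\<^sup>2 / 49)"
    by (intro sum.cong refl) (simp add: E_def h_diag power2_eq_square field_simps)
  moreover have "\<dots> = 1/9 * G + 2/21 * F * (3 * F) + 8 * (F\<^sup>2 / 49)"
    by (simp only: sum.distrib flip: sum_distrib_left) (simp add: sum_g G_def cardP)
  moreover have "(\<Sum>x\<in>P. \<Sum>y\<in>P. (E x y)\<^sup>2) =
     (\<Sum>x\<in>P. \<Sum>y\<in>P. (h x y)\<^sup>2 + 1/9 * (g x)\<^sup>2 + 1/9 * (g y)\<^sup>2 + 2/9 * g x * g y + F\<^sup>2 / 49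
        - 2/3 * g x * h x y - 2/3 * (g y * h y x) + 2/7 * F * h x y - 2/21 * F * g x - 2/21 * F * g y)"
    by (intro sum.cong refl) (simp add: E_def h_sym power2_eq_square field_simps)
  moreover have "\<dots> = K + 8 * (1/9 * G) + 8 * (1/9 * G) + 2/9 * (3 * F) * (3 * F) + 64 * (F\<^sup>2 / 49)
        - 2/3 * (3 * G) - 2/3 * (3 * G) + 2/7 * F * (9 * F) - 8 * (2/21 * F * (3 * F)) - 8 * (2/21 * F * (3 * F))"
  proof -
    have s1: "(\<Sum>x\<in>P. \<Sum>y\<in>P. 2/3 * g x * h x y) = 2/3 * (3 * G)"
      unfolding G_def sum_distrib_left[symmetric] sum_h by (simp add: power2_eq_square sum_distrib_left mult_ac)
    have s2: "(\<Sum>x\<in>P. \<Sum>y\<in>P. 2/3 * (g y * h y x)) = 2/3 * (3 * G)"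
      by (subst sum.swap) (use s1 in \<open>simp add: mult.assoc\<close>)
    have s3: "(\<Sum>x\<in>P. \<Sum>y\<in>P. 2/9 * g x * g y) = 2/9 * (3 * F) * (3 * F)"
      unfolding sum_distrib_left[symmetric] sum_g sum_distrib_right[symmetric] ..
    have s4: "(\<Sum>x\<in>P. \<Sum>y\<in>P. 2/7 * F * h x y) = 2/7 * F * (9 * F)"
      unfolding sum_distrib_left[symmetric] sum_h sum_g by simp
    have s5: "(\<Sum>x\<in>P. \<Sum>y\<in>P. 1/9 * (g x)\<^sup>2) = 8 * (1/9 * G)" "(\<Sum>x\<in>P. \<Sum>y\<in>P. 1/9 * (g y)\<^sup>2) = 8 * (1/9 * G)"
      by (simp_all add: G_def cardP sum_distrib_left)
    have s6: "(\<Sum>x\<in>P. \<Sum>y\<in>P. 2/21 * F * g x) = 8 * (2/21 * F * (3 * F))" "(\<Sum>x\<in>P. \<Sum>y\<in>P. 2/21 * F * g y) = 8 * (2/21 * F * (3 * F))"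
      unfolding sum_constant sum_distrib_left[symmetric] sum_g cardP by simp_all
    show ?thesis
      by (simp only: sum.distrib sum_subtractf s1 s2 s3 s4 s5 s6) (simp add: K_def cardP)
  qed
  ultimately have sq2: "0 \<le> K - 7/3 * G + 6/7 * F\<^sup>2"
    by (simp add: power2_eq_square field_simps)
  \<comment> \<open>The difference of the two sides is 5 times \<open>sq1\<close> plus half of
    \<open>sq2\<close>. The matrix \<open>M + 6 I - 2/7 J\<close> has eigenvalues 0, 0, 9, 5 on the
    four eigenspaces of M: \<open>sq1\<close> supplies 5 on the last two, \<open>sq2\<close> the
    missing 4.\<close>
  show ?thesis
    unfolding form using sq1 sq2 by (simp flip: F_def q_def)
qed

section \<open>Edge expansion and the weight of one component\<close>

text \<open>Vertices at distance two are joined by a walk of length two.  A walk A, N, B from C to its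
  complement crosses the boundary, and a boundary edge lies on at most 9 such walks as its first
  and on at most 9 as its second edge, since N has a neighbour on either side.\<close>

lemma K83_edge_expansion:
  assumes "C \<subseteq> K83"
  shows "card C * (56 - card C) \<le> 19 * (10 * card C - (\<Sum>A\<in>C. \<Sum>B\<in>C. adj A B))"
    and "(\<Sum>A\<in>C. \<Sum>B\<in>C. adj A B) \<le> 10 * card C"
proof -
  define bd :: nat where "bd = (\<Sum>A\<in>C. \<Sum>B\<in>K83-C. adj A B)"
  define n :: "nat set \<Rightarrow> nat" where "n N = (\<Sum>A\<in>C. adj N A)" for N
  define n' :: "nat set \<Rightarrow> nat" where "n' N = (\<Sum>A\<in>K83-C. adj N A)" for N
  have finC: "finite C" using assms finite_subset K83_finite by blast
  have sym: "kneser_adj A B \<longleftrightarrow> kneser_adj B A" for A B by (auto simp: kneser_adj_def)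
  have nn': "n N + n' N = 10" if "N \<in> K83" for N
    using K83_degree[OF that] sum.subset_diff[OF assms K83_finite, of "\<lambda>A. adj N A :: nat"]
    by (simp add: n_def n'_def)
  have bd1: "(\<Sum>N\<in>C. n' N) = bd" by (simp add: bd_def n'_def)
  have bd2: "(\<Sum>N\<in>K83-C. n N) = bd" unfolding bd_def n_def by (subst sum.swap) (simp add: sym)
  have total: "(\<Sum>A\<in>C. \<Sum>B\<in>C. adj A B) + bd = 10 * card C"
  proof -
    have "(\<Sum>A\<in>C. n A + n' A) = (\<Sum>A\<in>C. 10)" by (intro sum.cong refl) (use nn' assms in auto)
    then show ?thesis by (simp add: sum.distrib bd1 n_def)
  qed
  have prod_le: "n N * n' N \<le> 9 * n N \<and> n N * n' N \<le> 9 * n' N" if "N \<in> K83" for N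
  proof -
    have "n N = 0 \<or> n' N = 0 \<or> n N \<le> 9 \<and> n' N \<le> 9" using nn'[OF that] by linarith
    then show ?thesis by (auto simp: mult.commute)
  qed
  have "(\<Sum>A\<in>C. \<Sum>B\<in>K83-C. \<Sum>N\<in>K83. adj N A * adj N B) = (\<Sum>N\<in>K83. n N * n' N)"
    unfolding n_def n'_def by (rule sum_sum_products[symmetric])
  also have "\<dots> = (\<Sum>N\<in>K83-C. n N * n' N) + (\<Sum>N\<in>C. n N * n' N)"
    by (rule sum.subset_diff[OF assms K83_finite])
  also have "\<dots> \<le> (\<Sum>N\<in>K83-C. 9 * n N) + (\<Sum>N\<in>C. 9 * n' N)"
    using assms prod_le by (intro add_mono sum_mono) auto
  also have "\<dots> = 18 * bd" by (simp add: bd1 bd2 flip: sum_distrib_left)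
  finally have walks: "(\<Sum>A\<in>C. \<Sum>B\<in>K83-C. \<Sum>N\<in>K83. adj N A * adj N B) \<le> 18 * bd" .
  have diam: "1 \<le> (\<Sum>N\<in>K83. adj N A * adj N B) + (adj A B :: nat)" if "A \<in> K83" "B \<in> K83" for A B
  proof (cases "kneser_adj A B")
    case False
    have fin: "finite A" "finite B" "card A = 3" "card B = 3" using that finite_subset by (auto simp: K83_iff)
    \<comment> \<open>Two intersecting triples cover at most five points, which leaves room for a
      common neighbour.\<close>
    have "card (A \<inter> B) > 0" using False fin by (simp add: kneser_adj_def card_gt_0_iff)
    then have "card (A \<union> B) \<le> 5" using card_Un_Int[OF fin(1,2)] fin by linarith
    moreover have "card ({1..8} - (A \<union> B)) = 8 - card (A \<union> B)"
      using that fin by (subst card_Diff_subset) (auto simp: K83_iff)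
    ultimately have "3 \<le> card ({1..8} - (A \<union> B))" by linarith
    then obtain N where N: "N \<subseteq> {1..8} - (A \<union> B)" "card N = 3" by (meson obtain_subset_with_card_n)
    then have NV: "N \<in> K83" and "kneser_adj N A" "kneser_adj N B" by (auto simp: K83_iff kneser_adj_def)
    then have "1 = (adj N A * adj N B :: nat)" by simp
    also have "\<dots> \<le> (\<Sum>N\<in>K83. adj N A * adj N B)" using NV by (intro member_le_sum) auto
    finally show ?thesis by simp
  qed simp
  have "card C * (56 - card C) = (\<Sum>A\<in>C. \<Sum>B\<in>K83-C. 1)"
    using assms finC by (simp add: card_Diff_subset card_K83)
  also have "\<dots> \<le> (\<Sum>A\<in>C. \<Sum>B\<in>K83-C. (\<Sum>N\<in>K83. adj N A * adj N B) + adj A B)"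
    using assms by (intro sum_mono diam) auto
  \<comment> \<open>Walks of length two account for \<open>18 * bd\<close>, adjacent pairs for one
    more \<open>bd\<close>.\<close>
  also have "\<dots> \<le> 19 * bd" using walks unfolding sum.distrib bd_def by linarith
  finally show "card C * (56 - card C) \<le> 19 * (10 * card C - (\<Sum>A\<in>C. \<Sum>B\<in>C. adj A B))"
    using total by (metis add_diff_cancel_left')
  \<comment> \<open>This guarantees that the natural subtraction in the first claim does not
    truncate.\<close>
  show "(\<Sum>A\<in>C. \<Sum>B\<in>C. adj A B) \<le> 10 * card C" using total by linarith
qed

lemma K83_not_adj_refl: "A \<in> K83 \<Longrightarrow> \<not> kneser_adj A A"
  by (auto simp: K83_iff kneser_adj_def)

text \<open>The trivial bound \<open>D \<le> m (m - 1)\<close> suffices up to \<open>m = 8\<close>; from \<open>m = 9\<close> on, edge expansion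
  takes over.\<close>

lemma K83_component_weight:
  fixes C :: "nat set set"
  defines "m \<equiv> card C" and "D \<equiv> (\<Sum>A\<in>C. \<Sum>B\<in>C. adj A B) :: nat"
  assumes "C \<subseteq> K83" "2 \<le> m" "m \<le> 45"
  shows "(3 * m + 5) * (6 * m + D) < 48 * m\<^sup>2"
proof (cases "m \<le> 8")
  case True
  have finC: "finite C" using assms finite_subset K83_finite by blast
  have "D \<le> (\<Sum>A\<in>C. card C - 1)" unfolding D_def
  proof (rule sum_mono)
    fix A assume A: "A \<in> C"
    have "(\<Sum>B\<in>C. adj A B) = (\<Sum>B\<in>C-{A}. adj A B :: nat)"
      using A K83_not_adj_refl assms finC by (subst sum.remove[of C A]) auto
    also have "\<dots> \<le> (\<Sum>B\<in>C-{A}. 1)" by (intro sum_mono) auto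
    finally show "(\<Sum>B\<in>C. adj A B) \<le> card C - 1" using A finC by simp
  qed
  then have D: "D \<le> m * (m - 1)" by (simp add: m_def)
  have "(3 * m + 5) * (6 * m + D) \<le> (3 * m + 5) * (6 * m + m * (m - 1))" using D by simp
  also have "\<dots> < 48 * m\<^sup>2"
  proof -
    have "m \<in> {2,3,4,5,6,7,8}" using True assms by auto
    then show ?thesis by auto
  qed
  finally show ?thesis .
next
  case False
  define b where "b = 10 * m - D"
  have b: "m * (56 - m) \<le> 19 * b" and D: "D = 10 * m - b" "b \<le> 10 * m"
    using K83_edge_expansion[OF assms(3)] by (auto simp: b_def m_def D_def)
  have "m \<in> set [9..<46]" using False assms by (simp only: set_upt) auto
  \<comment> \<open>Rounding up matters at 9: expansion gives \<open>423 \<le> 19 * b\<close>, and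
    the fractional value 423/19 would be too small, whereas 23 yields
    \<open>32 * 121 = 3872 < 3888\<close>.\<close>
  moreover have "23 \<le> b" if "m = 9" using b that by simp
  ultimately show ?thesis using b D by (auto simp: upt_rec)
qed

section \<open>The counting inequality for separated families\<close>

text \<open>Phrased for pairwise separated sets so as to serve both the components left by a cut and
  the singletons of an independent set.\<close>

lemma K83_separated_family:
  assumes sub: "\<And>C. C \<in> Q \<Longrightarrow> C \<subseteq> K83" and ne: "{} \<notin> Q"
    and disj: "\<And>C C'. C \<in> Q \<Longrightarrow> C' \<in> Q \<Longrightarrow> C \<noteq> C' \<Longrightarrow> C \<inter> C' = {}"
    and sep: "\<And>C C' A B. C \<in> Q \<Longrightarrow> C' \<in> Q \<Longrightarrow> C \<noteq> C' \<Longrightarrow> A \<in> C \<Longrightarrow> B \<in> C' \<Longrightarrow> \<not> kneser_adj A B"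
    and two: "2 \<le> card Q"
  shows "3 * card (\<Union>Q) + 5 * card Q \<le> 168"
    and "3 * card (\<Union>Q) + 5 * card Q = 168 \<Longrightarrow> C \<in> Q \<Longrightarrow> card C = 1"
proof -
  have finQ: "finite Q" using two by (intro card_ge_0_finite) linarith
  have finC: "finite C" if "C \<in> Q" for C using sub[OF that] finite_subset K83_finite by blast
  have subU: "\<Union>Q \<subseteq> K83" using sub by blast
  define D :: "nat set set \<Rightarrow> nat" where "D C = (\<Sum>A\<in>C. \<Sum>B\<in>C. adj A B)" for C
  \<comment> \<open>By Cauchy-Schwarz this weight maximises the quotient of
    \<open>(\<Sum> m w)\<^sup>2\<close> by \<open>\<Sum> (6 m + D) w\<^sup>2\<close>. It satisfies
    \<open>(6 m + D) w\<^sup>2 = m w\<close>, so the form at the test vector collapses to the plain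
    sum \<open>T\<close>.\<close>
  define w :: "nat set set \<Rightarrow> real" where "w C = card C / (6 * card C + D C)" for C
  have card_pos: "0 < card C" if "C \<in> Q" for C
    using that ne finC by (metis card_gt_0_iff)
  \<comment> \<open>A vertex of another member and its ten neighbours all lie outside
    \<open>C\<close>, and 56 - 11 = 45.\<close>
  have card_le: "card C \<le> 45" if C: "C \<in> Q" for C
  proof -
    obtain C' where C': "C' \<in> Q" "C' \<noteq> C"
      using two C by (metis card_le_Suc0_iff_eq finQ not_less_eq_eq numeral_2_eq_2)
    then obtain v where v: "v \<in> C'" using ne by fastforce
    then have vV: "v \<in> K83" using sub C' by blast
    define N where "N = {B \<in> K83. kneser_adj v B}"
    have "card N = 10"
      using K83_degree[OF vV] by (simp add: N_def sum_of_bool_eq Collect_conj_eq)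
    moreover have "v \<notin> N" using K83_not_adj_refl[OF vV] by (simp add: N_def)
    moreover have "finite N" by (simp add: N_def)
    ultimately have "card (insert v N) = 11" by simp
    moreover have "C \<subseteq> K83 - insert v N"
      using sub[OF C] sep[OF C'(1) C C'(2) v] disj[OF C'(1) C C'(2)] v by (auto simp: N_def)
    then have "card C \<le> card (K83 - insert v N)" by (intro card_mono) auto
    moreover have "card (K83 - insert v N) = 56 - card (insert v N)"
      using vV \<open>finite N\<close> by (subst card_Diff_subset) (auto simp: N_def card_K83)
    ultimately show ?thesis by simp
  qed
  have weight: "(3 * card C + 5) * (6 * card C + D C) \<le> 48 * (card C)\<^sup>2"
    and weight_strict: "card C \<noteq> 1 \<Longrightarrow> (3 * card C + 5) * (6 * card C + D C) < 48 * (card C)\<^sup>2"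
    if C: "C \<in> Q" for C
  proof -
    show strict: "(3 * card C + 5) * (6 * card C + D C) < 48 * (card C)\<^sup>2" if "card C \<noteq> 1"
      unfolding D_def using that card_pos[OF C] card_le[OF C] sub[OF C]
      by (intro K83_component_weight) auto
    show "(3 * card C + 5) * (6 * card C + D C) \<le> 48 * (card C)\<^sup>2"
    proof (cases "card C = 1")
      \<comment> \<open>A single vertex has \<open>D C = 0\<close>, and both sides equal 48.\<close>
      case True
      then obtain v where "C = {v}" by (auto simp: card_1_singleton_iff)
      then show ?thesis using sub[OF C] K83_not_adj_refl by (simp add: D_def)
    qed (use strict in simp)
  qed
  have w_ge: "3 * real (card C) + 5 \<le> 48 * (card C * w C)"
    and w_gt: "card C \<noteq> 1 \<Longrightarrow> 3 * real (card C) + 5 < 48 * (card C * w C)" if C: "C \<in> Q" for C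
  proof -
    have pos: "0 < 6 * real (card C) + real (D C)" using card_pos[OF C] by simp
    have eq: "48 * (card C * w C) = real (48 * (card C)\<^sup>2) / (6 * card C + D C)"
      by (simp add: w_def power2_eq_square)
    have "real ((3 * card C + 5) * (6 * card C + D C)) \<le> real (48 * (card C)\<^sup>2)"
      using weight[OF C] by (simp only: of_nat_le_iff)
    then show "3 * real (card C) + 5 \<le> 48 * (card C * w C)"
      unfolding eq using pos by (simp add: pos_le_divide_eq)
    assume "card C \<noteq> 1"
    then have "real ((3 * card C + 5) * (6 * card C + D C)) < real (48 * (card C)\<^sup>2)"
      unfolding of_nat_less_iff by (rule weight_strict[OF C])
    then show "3 * real (card C) + 5 < 48 * (card C * w C)"
      unfolding eq using pos by (simp add: pos_less_divide_eq)
  qed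

  \<comment> \<open>Disjointness makes the member containing a vertex unique, so \<open>f\<close> is
    constant on each member; it is 0 outside their union.\<close>
  define cls where "cls A = (THE C. C \<in> Q \<and> A \<in> C)" for A
  define f where "f A = (if A \<in> \<Union>Q then w (cls A) else 0)" for A
  have cls: "cls A = C" if "C \<in> Q" "A \<in> C" for A C
    unfolding cls_def using that disj by (intro the_equality) auto
  have f: "f A = w C" if "C \<in> Q" "A \<in> C" for A C
    using that cls by (auto simp: f_def)
  have sum_Q: "(\<Sum>A\<in>K83. g A) = (\<Sum>C\<in>Q. \<Sum>A\<in>C. g A)" if "\<And>A. A \<notin> \<Union>Q \<Longrightarrow> g A = 0" for g :: "nat set \<Rightarrow> real"
  proof -
    have "(\<Sum>A\<in>K83. g A) = (\<Sum>A\<in>\<Union>Q. g A)"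
      using that subU by (intro sum.mono_neutral_right) auto
    also have "\<dots> = (\<Sum>C\<in>Q. \<Sum>A\<in>C. g A)"
      using finC disj by (subst sum.Union_disjoint) auto
    finally show ?thesis .
  qed
  define T where "T = (\<Sum>C\<in>Q. card C * w C)"
  have "(\<Sum>A\<in>K83. f A) = (\<Sum>C\<in>Q. \<Sum>A\<in>C. w C)"
    by (subst sum_Q, simp add: f_def) (intro sum.cong refl, simp add: f)
  then have sum_f: "(\<Sum>A\<in>K83. f A) = T" by (simp add: T_def)
  have "(\<Sum>A\<in>K83. (f A)\<^sup>2) = (\<Sum>C\<in>Q. \<Sum>A\<in>C. (w C)\<^sup>2)"
    by (subst sum_Q, simp add: f_def) (intro sum.cong refl, simp add: f)
  then have sum_f2: "(\<Sum>A\<in>K83. (f A)\<^sup>2) = (\<Sum>C\<in>Q. card C * (w C)\<^sup>2)" by simp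
  have inner: "(\<Sum>B\<in>K83. adj A B * (f A * f B)) = (\<Sum>B\<in>C. adj A B) * (w C)\<^sup>2" if "C \<in> Q" "A \<in> C" for A C
  proof -
    \<comment> \<open>Terms with \<open>B\<close> in another member vanish by separation, the
      remaining ones outside \<open>C\<close> because \<open>f B = 0\<close>.\<close>
    have "(\<Sum>B\<in>K83. adj A B * (f A * f B)) = (\<Sum>B\<in>C. adj A B * (f A * f B))"
      using that sub sep by (intro sum.mono_neutral_right) (auto simp: f_def, blast+)
    also have "\<dots> = (\<Sum>B\<in>C. adj A B * (w C)\<^sup>2)"
      using that by (intro sum.cong refl) (simp add: f power2_eq_square)
    finally show ?thesis by (simp only: sum_distrib_right)
  qed
  have "(\<Sum>A\<in>K83. \<Sum>B\<in>K83. adj A B * (f A * f B)) = (\<Sum>C\<in>Q. \<Sum>A\<in>C. (\<Sum>B\<in>C. adj A B) * (w C)\<^sup>2)"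
    by (subst sum_Q, simp add: f_def) (intro sum.cong refl inner)
  also have "\<dots> = (\<Sum>C\<in>Q. D C * (w C)\<^sup>2)"
    unfolding D_def of_nat_sum of_nat_of_bool sum_distrib_right ..
  finally have form: "(\<Sum>A\<in>K83. \<Sum>B\<in>K83. adj A B * (f A * f B)) = (\<Sum>C\<in>Q. D C * (w C)\<^sup>2)" .
  have "2/7 * T\<^sup>2 \<le> (\<Sum>C\<in>Q. D C * (w C)\<^sup>2) + 6 * (\<Sum>C\<in>Q. card C * (w C)\<^sup>2)"
    using K83_quadratic_form_lower_bound[of f] unfolding sum_f sum_f2 form .
  also have "\<dots> = (\<Sum>C\<in>Q. (6 * card C + D C) * (w C)\<^sup>2)"
    by (simp add: sum_distrib_left sum.distrib algebra_simps)
  also have "\<dots> = T"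
    unfolding T_def
  proof (intro sum.cong refl)
    fix C assume "C \<in> Q"
    then have "(6 * card C + D C) * w C = card C" using card_pos[of C] by (simp add: w_def)
    then show "(6 * card C + D C) * (w C)\<^sup>2 = card C * w C" by (simp add: power2_eq_square flip: mult.assoc)
  qed
  finally have T2: "2/7 * T\<^sup>2 \<le> T" .
  have T_le: "T \<le> 7/2"
  proof (rule ccontr)
    assume "\<not> T \<le> 7/2"
    then have "7/2 * T < T * T" by (intro mult_strict_right_mono) auto
    then show False using T2 by (simp add: power2_eq_square)
  qed
  have cardU: "card (\<Union>Q) = (\<Sum>C\<in>Q. card C)"
    using finC disj by (intro card_Union_disjoint) (auto simp: pairwise_def disjnt_def)
  have count: "real (3 * card (\<Union>Q) + 5 * card Q) = (\<Sum>C\<in>Q. 3 * real (card C) + 5)"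
    by (simp add: cardU sum.distrib sum_distrib_left)
  have T48: "48 * T = (\<Sum>C\<in>Q. 48 * (card C * w C))" by (simp add: T_def sum_distrib_left)
  have "(\<Sum>C\<in>Q. 3 * real (card C) + 5) \<le> 48 * T"
    unfolding T48 by (intro sum_mono w_ge)
  \<comment> \<open>Here 168 arises as 48 times 7/2.\<close>
  then have "real (3 * card (\<Union>Q) + 5 * card Q) \<le> 168" using T_le count by linarith
  then show "3 * card (\<Union>Q) + 5 * card Q \<le> 168" by linarith
  show "card C = 1" if "3 * card (\<Union>Q) + 5 * card Q = 168" "C \<in> Q"
  proof (rule ccontr)
    assume "card C \<noteq> 1"
    \<comment> \<open>One member that is not a singleton makes the summed inequality strict, leading
      to 168 < 168.\<close>
    then have "(\<Sum>C\<in>Q. 3 * real (card C) + 5) < 48 * T"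
      unfolding T48 using finQ w_ge w_gt \<open>C \<in> Q\<close> by (intro sum_strict_mono_ex1) auto
    then show False using T_le count that(1) by linarith
  qed
qed

text \<open>The singletons of \<open>J\<close> are separated, hence
  \<open>8 * card J \<le> 168\<close>.\<close>

lemma K83_independent_card_le:
  assumes "independent_set K83 kneser_adj J"
  shows "card J \<le> 21"
proof (cases "2 \<le> card J")
  case True
  let ?Q = "(\<lambda>A. {A}) ` J"
  have card: "card ?Q = card J" by (simp add: card_image)
  have "3 * card (\<Union>?Q) + 5 * card ?Q \<le> 168"
    using assms True card by (intro K83_separated_family) (auto simp: independent_set_def)
  then show ?thesis unfolding card by simp
qed simp

section \<open>Components and vertex cuts\<close>

lemma equiv_conn_rel:
  assumes "\<And>x y. E x y \<Longrightarrow> E y x"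
  shows "equiv (V - S) (conn_rel V E S)"
proof -
  have "sym ({(x,y). x \<in> V - S \<and> y \<in> V - S \<and> E x y}\<^sup>*)"
    using assms by (intro sym_rtrancl) (auto simp: sym_def)
  then show ?thesis
    by (intro equivI) (auto simp: conn_rel_def refl_on_def sym_def intro!: transI)
qed

lemma equiv_conn_rel_kneser: "equiv (V - S) (conn_rel V kneser_adj S)"
  by (rule equiv_conn_rel) (auto simp: kneser_adj_def)

text \<open>The components form a separated family covering \<open>56 - card S\<close> vertices, and
  3 * 56 = 168 cancels the constant. Equality forces singletons, so
  \<open>8 * card U = 168\<close>.\<close>

lemma K83_vertex_cut_bound:
  assumes "vertex_cut K83 kneser_adj S"
  shows "5 * num_components K83 kneser_adj S \<le> 3 * card S"
    and "5 * num_components K83 kneser_adj S = 3 * card S \<Longrightarrow> maximum_independent_set K83 kneser_adj (K83 - S)"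
proof -
  define U where "U = K83 - S"
  define R where "R = conn_rel K83 kneser_adj S"
  define Q where "Q = U // R"
  have S: "S \<subseteq> K83" and two: "2 \<le> card Q" and nc: "num_components K83 kneser_adj S = card Q"
    using assms by (auto simp: vertex_cut_def num_components_def Q_def U_def R_def)
  have equiv: "equiv U R" unfolding U_def R_def by (rule equiv_conn_rel_kneser)
  have Un: "\<Union>Q = U" unfolding Q_def using equiv by (rule Union_quotient)
  have cardU: "card U = 56 - card S" "card S \<le> 56"
    using S by (auto simp: U_def card_Diff_subset finite_subset[OF S] card_K83[symmetric] card_mono)
  have adjR: "(A, B) \<in> R" if "A \<in> U" "B \<in> U" "kneser_adj A B" for A B
    using that by (auto simp: R_def U_def conn_rel_def)
  have sub: "C \<subseteq> K83" if "C \<in> Q" for C using that Un by (auto simp: U_def)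
  have ne: "{} \<notin> Q" using equiv in_quotient_imp_non_empty by (auto simp: Q_def)
  have disj: "C \<inter> C' = {}" if "C \<in> Q" "C' \<in> Q" "C \<noteq> C'" for C C'
    using that quotient_disj[OF equiv] unfolding Q_def by blast
  have sep: "\<not> kneser_adj A B" if "C \<in> Q" "C' \<in> Q" "C \<noteq> C'" "A \<in> C" "B \<in> C'" for C C' A B
  proof
    assume "kneser_adj A B"
    moreover have "A \<in> U" "B \<in> U" using that Un by auto
    ultimately have "(A, B) \<in> R" by (intro adjR)
    then show False using that quotient_eqI[OF equiv, of C C' A B] by (auto simp: Q_def)
  qed
  have "3 * card (\<Union>Q) + 5 * card Q \<le> 168"
    by (rule K83_separated_family(1)) (fact sub ne disj sep two)+
  then have "3 * (56 - card S) + 5 * card Q \<le> 168" using Un cardU by simp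
  then show "5 * num_components K83 kneser_adj S \<le> 3 * card S"
    using cardU nc by linarith
  assume "5 * num_components K83 kneser_adj S = 3 * card S"
  then have eq: "3 * card (\<Union>Q) + 5 * card Q = 168" using cardU nc Un by simp
  have single: "card C = 1" if "C \<in> Q" for C
    by (rule K83_separated_family(2)[where Q = Q]) (fact sub ne disj sep two eq that)+
  have "card U = (\<Sum>C\<in>Q. card C)"
    unfolding Un[symmetric] using disj finite_subset[OF sub K83_finite]
    by (intro card_Union_disjoint) (auto simp: pairwise_def disjnt_def)
  then have "card U = card Q" using single by simp
  then have card21: "card U = 21" using eq Un by simp
  have "independent_set K83 kneser_adj U"
    unfolding independent_set_def
  \<comment> \<open>Adjacent vertices of \<open>U\<close> share a component; being a singleton, it
    would make the vertex adjacent to itself.\<close>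
  proof (intro conjI ballI notI)
    fix A B assume AB: "A \<in> U" "B \<in> U" "kneser_adj A B"
    then obtain C where C: "C \<in> Q" "A \<in> C" using Un by blast
    then have "B \<in> C"
      using adjR[OF AB] equiv by (metis Q_def in_quotient_imp_closed)
    then have "A = B" using C single[OF C(1)] by (metis card_1_singletonE singletonD)
    then show False using AB K83_not_adj_refl by (auto simp: U_def)
  qed (auto simp: U_def)
  then show "maximum_independent_set K83 kneser_adj (K83 - S)"
    using card21 K83_independent_card_le by (simp add: maximum_independent_set_def flip: U_def)
qed

section \<open>The extremal cut and the toughness\<close>

text \<open>Triples containing 1 meet pairwise, so deleting all others leaves isolated vertices
  only. This cut attains the ratio 35/21 = 5/3.\<close>

lemma K83_star_complement_cut:
  defines "S \<equiv> {A \<in> K83. 1 \<notin> A}"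
  shows "num_components K83 kneser_adj S = 21" "card S = 35"
proof -
  have star: "K83 - S = {A \<in> K83. 1 \<in> A}" by (auto simp: S_def)
  have card_star: "card {A \<in> K83. 1 \<in> A} = 21"
    using K83_incidence[of 1] by (simp add: sum_of_bool_eq Collect_conj_eq)
  have "{(x,y). x \<in> K83 - S \<and> y \<in> K83 - S \<and> kneser_adj x y} = {}"
    unfolding star by (auto simp: kneser_adj_def)
  then have "conn_rel K83 kneser_adj S = Id_on (K83 - S)"
    by (auto simp only: conn_rel_def rtrancl_empty)
  then have "(K83 - S) // conn_rel K83 kneser_adj S = (\<lambda>A. {A}) ` (K83 - S)"
    by (auto simp: quotient_def)
  then show "num_components K83 kneser_adj S = 21"
    by (simp only: num_components_def card_image[OF inj_singleton] star card_star)
  have "S \<subseteq> K83" by (auto simp: S_def)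
  then have "card (K83 - S) = 56 - card S" "card S \<le> 56"
    by (auto simp: card_Diff_subset finite_subset card_K83[symmetric] card_mono)
  then show "card S = 35" using card_star star by simp
qed

theorem theorem4p2:
  shows "toughness (kneser_vertices 8 3) kneser_adj = 5 / 3 \<and>
    (\<forall>S. vertex_cut (kneser_vertices 8 3) kneser_adj S \<and>
         real (card S) / real (num_components (kneser_vertices 8 3) kneser_adj S) = 5 / 3
       \<longrightarrow> (\<exists>I. maximum_independent_set (kneser_vertices 8 3) kneser_adj I \<and>
                S = kneser_vertices 8 3 - I))"
proof (intro conjI allI impI)
  show "toughness K83 kneser_adj = 5 / 3"
    unfolding toughness_def
  proof (rule cInf_eq_minimum)
    let ?S = "{A \<in> K83. 1 \<notin> A}"
    have "vertex_cut K83 kneser_adj ?S" using K83_star_complement_cut by (auto simp: vertex_cut_def)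
    moreover have "5 / 3 = real (card ?S) / real (num_components K83 kneser_adj ?S)"
      unfolding K83_star_complement_cut by simp
    ultimately show "5 / 3 \<in> {real (card S) / real (num_components K83 kneser_adj S) | S. vertex_cut K83 kneser_adj S}"
      by blast
  next
    fix r assume "r \<in> {real (card S) / real (num_components K83 kneser_adj S) | S. vertex_cut K83 kneser_adj S}"
    then obtain S where S: "vertex_cut K83 kneser_adj S" "r = real (card S) / real (num_components K83 kneser_adj S)"
      by blast
    \<comment> \<open>Division by zero yields 0, so positivity is established before the denominator
      is cleared.\<close>
    then have "0 < num_components K83 kneser_adj S" by (simp add: vertex_cut_def)
    then show "5 / 3 \<le> r" using K83_vertex_cut_bound(1)[OF S(1)] S(2)
      by (simp add: pos_le_divide_eq)
  qed
next
  fix S assume S: "vertex_cut K83 kneser_adj S \<and> real (card S) / real (num_components K83 kneser_adj S) = 5 / 3"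
  then have "0 < num_components K83 kneser_adj S" by (simp add: vertex_cut_def)
  then have "5 * num_components K83 kneser_adj S = 3 * card S" using S by (simp add: field_simps)
  then have "maximum_independent_set K83 kneser_adj (K83 - S)" using S K83_vertex_cut_bound(2) by blast
  moreover have "S = K83 - (K83 - S)" using S by (auto simp: vertex_cut_def)
  ultimately show "\<exists>I. maximum_independent_set K83 kneser_adj I \<and> S = K83 - I" by blast
qed

end
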